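(* Let $k\ge 3$, $n\ge k$ and $L\ge 0$ be integers. Let $P_{n,L}(k\text{-XOR-SAT})$ denote the probability that a random $k$-XOR-formula drawn uniformly from $\Omega(n,L,k)$ is satisfiable. Let $A$ be chosen uniformly at random from the set $M_{L,n,k}$ of Boolean $L\times n$ matrices having exactly $k$ entries equal to $1$ in each row, let $Y(A)$ denote the number of vectors in the kernel of the transpose $A^{T}$ (over $GF(2)$), and for $0\le r\le L$ let $P_{(r)}$ be the probability that $A$ has rank $r$ over $GF(2)$. Then $$P_{n,L}(k\text{-XOR-SAT})=\sum_{r=0}^{L}2^{r-L}P_{(r)}=E_{L,k}(1/Y),$$ where $E_{L,k}$ denotes expectation with respect to the uniform choice of $A\in M_{L,n,k}$.
   Context: A $k$-XOR-clause over the variables $x_1,\dots,x_n$ is a linear equation over $GF(2)$ of the form $x_{i_1}\oplus\cdots\oplus x_{i_k}=\varepsilon$ with $i_1<\dots<i_k$ distinct and $\varepsilon\in\{0,1\}$; there are $N_k=2\binom{n}{k}$ such clauses. A truth assignment $I:\{x_1,\dots,x_n\}\to\{0,1\}$ satisfies such a clause iff $\sum_j I(x_{i_j})\equiv\varepsilon \pmod 2$, and satisfies a formula (conjunction of clauses) iff it satisfies every clause. $\Omega(n,L,k)$ is the probability space of all ordered $L$-tuples of $k$-XOR-clauses over $n$ variables (chosen uniformly, independently, with replacement), each tuple having probability $(2\binom nk)^{-L}$. *)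

theory Defs
  imports
    "HOL-Probability.Probability_Mass_Function"
    "HOL-Library.Z2"
    "HOL-Library.FuncSet"
    "Jordan_Normal_Form.DL_Rank"
    "Jordan_Normal_Form.Matrix_Kernel"
begin

text \<open>
  GF(2) is the type \<^typ>\<open>bit\<close>, whose addition is exclusive or. The variables
  \<open>x\<^sub>1, \<dots>, x\<^sub>n\<close> are numbered \<open>0, \<dots>, n - 1\<close>, like the columns of a matrix.
  A pair \<open>(S, e)\<close> stands for the equation whose left-hand side is the sum of the variables
  in \<open>S\<close> and whose right-hand side is \<open>e\<close>.
\<close>

type_synonym xor_clause = "nat set \<times> bit"

definition xor_clauses :: "nat \<Rightarrow> nat \<Rightarrow> xor_clause set" where
  "xor_clauses n k = {(S, e). S \<subseteq> {..<n} \<and> card S = k}"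

definition xor_formulas :: "nat \<Rightarrow> nat \<Rightarrow> nat \<Rightarrow> xor_clause list set" where
  "xor_formulas n L k = {F. length F = L \<and> set F \<subseteq> xor_clauses n k}"

definition satisfies_clause :: "(nat \<Rightarrow> bit) \<Rightarrow> xor_clause \<Rightarrow> bool" where
  "satisfies_clause I c \<longleftrightarrow> (\<Sum>j\<in>fst c. I j) = snd c"

definition satisfies_formula :: "(nat \<Rightarrow> bit) \<Rightarrow> xor_clause list \<Rightarrow> bool" where
  "satisfies_formula I F \<longleftrightarrow> (\<forall>c\<in>set F. satisfies_clause I c)"

definition assignments :: "nat \<Rightarrow> (nat \<Rightarrow> bit) set" where
  "assignments n = {..<n} \<rightarrow>\<^sub>E UNIV"

definition xor_satisfiable :: "nat \<Rightarrow> xor_clause list \<Rightarrow> bool" where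
  "xor_satisfiable n F \<longleftrightarrow> (\<exists>I\<in>assignments n. satisfies_formula I F)"

definition random_xor_formula :: "nat \<Rightarrow> nat \<Rightarrow> nat \<Rightarrow> xor_clause list pmf" where
  "random_xor_formula n L k = pmf_of_set (xor_formulas n L k)"

definition prob_xor_sat :: "nat \<Rightarrow> nat \<Rightarrow> nat \<Rightarrow> real" where
  "prob_xor_sat n L k =
     measure_pmf.prob (random_xor_formula n L k) {F. xor_satisfiable n F}"

definition row_matrices :: "nat \<Rightarrow> nat \<Rightarrow> nat \<Rightarrow> bit mat set" where
  "row_matrices L n k =
     {A \<in> carrier_mat L n. \<forall>i<L. card {j. j < n \<and> A $$ (i, j) = 1} = k}"

definition random_matrix :: "nat \<Rightarrow> nat \<Rightarrow> nat \<Rightarrow> bit mat pmf" where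
  "random_matrix L n k = pmf_of_set (row_matrices L n k)"

text \<open>
  The library rank is the dimension of the column span; it takes the number of rows as an
  explicit argument.
\<close>

definition mat_rank :: "bit mat \<Rightarrow> nat" where
  "mat_rank A = vec_space.rank (dim_row A) A"

definition prob_rank :: "nat \<Rightarrow> nat \<Rightarrow> nat \<Rightarrow> nat \<Rightarrow> real" where
  "prob_rank L n k r = measure_pmf.prob (random_matrix L n k) {A. mat_rank A = r}"

definition num_left_kernel :: "bit mat \<Rightarrow> nat" where
  "num_left_kernel A = card (mat_kernel (transpose_mat A))"

text \<open>
  \<^const>\<open>pmf_of_set\<close> is the uniform distribution only on finite nonempty sets; both sample
  spaces qualify when \<open>k \<le> n\<close>.
\<close>

lemma UNIV_bit_eq: "(UNIV :: bit set) = {0, 1}"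
proof -
  have "x = 0 \<or> x = 1" for x :: bit
    by (cases x) auto
  thus ?thesis
    by blast
qed

lemma finite_UNIV_bit: "finite (UNIV :: bit set)"
  by (subst UNIV_bit_eq) simp

lemma card_UNIV_bit: "card (UNIV :: bit set) = 2"
  by (subst UNIV_bit_eq) simp

lemma xor_clauses_eq: "xor_clauses n k = {S. S \<subseteq> {..<n} \<and> card S = k} \<times> UNIV"
  by (auto simp: xor_clauses_def)

lemma finite_xor_clauses: "finite (xor_clauses n k)"
  unfolding xor_clauses_eq
  by (intro finite_cartesian_product finite_UNIV_bit)
     (rule finite_subset[of _ "Pow {..<n}"], auto)

lemma card_xor_clauses: "card (xor_clauses n k) = 2 * (n choose k)"
  by (simp add: xor_clauses_eq card_cartesian_product n_subsets card_UNIV_bit)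

lemma finite_xor_formulas: "finite (xor_formulas n L k)"
  using finite_lists_length_eq[OF finite_xor_clauses]
  by (simp add: xor_formulas_def conj_commute)

lemma card_xor_formulas: "card (xor_formulas n L k) = (2 * (n choose k)) ^ L"
  using card_lists_length_eq[OF finite_xor_clauses, of n k L]
  by (simp add: xor_formulas_def conj_commute card_xor_clauses)

lemma pmf_random_xor_formula:
  assumes "k \<le> n" and "F \<in> xor_formulas n L k"
  shows "pmf (random_xor_formula n L k) F = 1 / (2 * real (n choose k)) ^ L"
proof -
  have "xor_formulas n L k \<noteq> {}"
    using assms(2) by blast
  thus ?thesis
    using assms(2)
    by (simp add: random_xor_formula_def finite_xor_formulas card_xor_formulas)
qed

lemma finite_row_matrices: "finite (row_matrices L n k)"
proof (rule finite_subset)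
  let ?D = "{..<L} \<times> {..<n}"
  let ?g = "\<lambda>f. mat L n f :: bit mat"
  show "row_matrices L n k \<subseteq> ?g ` (?D \<rightarrow>\<^sub>E UNIV)"
  proof
    fix A assume A: "A \<in> row_matrices L n k"
    have "A = ?g (restrict (\<lambda>p. A $$ p) ?D)"
      using A by (intro eq_matI) (auto simp: row_matrices_def)
    thus "A \<in> ?g ` (?D \<rightarrow>\<^sub>E UNIV)"
      by (rule ssubst) (intro imageI, simp only: restrict_PiE_iff, simp)
  qed
  show "finite (?g ` (?D \<rightarrow>\<^sub>E UNIV))"
    by (intro finite_imageI finite_PiE) (auto simp: finite_UNIV_bit)
qed

lemma row_matrices_nonempty:
  assumes "k \<le> n"
  shows "row_matrices L n k \<noteq> {}"
proof -
  let ?A = "mat L n (\<lambda>(i, j). if j < k then 1 else 0) :: bit mat"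
  have "{j. j < n \<and> ?A $$ (i, j) = 1} = {..<k}" if "i < L" for i
    using that assms by (auto split: if_splits)
  hence "?A \<in> row_matrices L n k"
    by (simp add: row_matrices_def)
  thus ?thesis
    by blast
qed

end

(*
  A formula is a linear system A x = b, where A ranges over the matrices with k ones per row and
  b over all of GF(2)^L, so exactly |im A| / 2^L = 2^(rank A - L) of the right-hand sides belonging
  to A are solvable. To see that this ratio is 1 / |ker A^T|, count the pairs (x, y) with
  y . (A x) = 0 in two ways: over a field with q elements this gives
  q^L |ker A| = q^n |ker A^T|, and |im A| |ker A| = q^n.
*)
theory Submission
  imports Defs
begin

text \<open>From here on \<open>$\<close> and \<open>\<bullet>\<close> are the entry and the scalar
  product of vectors in \<open>carrier_vec\<close>, free of the meanings that analysis gives to the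
  same symbols.\<close>

unbundle no vec_syntax and no inner_syntax

section \<open>Cardinalities of vector sets, spans and column spaces\<close>

text \<open>Serves twice: to count vectors, and to turn truth assignments, which form just such a
  function space over \<open>bit\<close>, into vectors.\<close>

lemma bij_betw_vec_carrier_vec:
  "bij_betw (vec n) ({..<n} \<rightarrow>\<^sub>E (UNIV :: 'a set)) (carrier_vec n)"
proof (rule bij_betwI[of _ _ _ "\<lambda>v. restrict (($) v) {..<n}"])
  fix f assume "f \<in> {..<n} \<rightarrow>\<^sub>E (UNIV :: 'a set)"
  then show "restrict (($) (vec n f)) {..<n} = f"
    by (auto simp: fun_eq_iff PiE_def extensional_def)
qed (auto intro!: eq_vecI)

lemma card_carrier_vec: "card (carrier_vec n :: 'a vec set) = card (UNIV :: 'a set) ^ n"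
  using bij_betw_same_card[OF bij_betw_vec_carrier_vec[where 'a = 'a and n = n]]
  by (simp add: card_PiE)

lemma finite_carrier_vec:
  assumes "finite (UNIV :: 'a set)"
  shows "finite (carrier_vec n :: 'a vec set)"
  using bij_betw_finite[OF bij_betw_vec_carrier_vec[where 'a = 'a and n = n]] assms
  by (simp add: finite_PiE)

text \<open>Forming linear combinations is a bijection from the coefficient functions on
  \<open>U\<close> to the span: independence makes it injective, finiteness of \<open>U\<close>
  makes it surjective.\<close>

lemma (in vec_space) card_span_lin_indpt:
  assumes fin: "finite U" and U: "U \<subseteq> carrier_vec n" and indpt: "lin_indpt U"
  shows "card (span U) = card (UNIV :: 'a set) ^ card U"
proof -
  have "inj_on (\<lambda>f. lincomb f U) (U \<rightarrow>\<^sub>E UNIV)"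
  proof (rule inj_onI)
    fix f g :: "'a vec \<Rightarrow> 'a"
    assume f: "f \<in> U \<rightarrow>\<^sub>E UNIV" and g: "g \<in> U \<rightarrow>\<^sub>E UNIV"
      and eq: "lincomb f U = lincomb g U"
    \<comment> \<open>Two coefficient functions with the same combination differ by a relation on
      \<open>U\<close>, and independence makes that relation trivial.\<close>
    have "lincomb (\<lambda>u. f u - g u) U = 0\<^sub>v n"
    proof (rule eq_vecI)
      show "dim_vec (lincomb (\<lambda>u. f u - g u) U) = dim_vec (0\<^sub>v n)"
        using U by (simp add: lincomb_dim[OF fin])
      fix i assume "i < dim_vec (0\<^sub>v n :: 'a vec)"
      then show "lincomb (\<lambda>u. f u - g u) U $ i = 0\<^sub>v n $ i"
        using arg_cong[OF eq, of "\<lambda>v. v $ i"] U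
        by (simp add: lincomb_index algebra_simps sum_subtractf)
    qed
    then have "(\<lambda>u. f u - g u) \<in> U \<rightarrow> {0}"
      using not_lindepD[OF indpt fin, of "\<lambda>u. f u - g u"] by auto
    then show "f = g"
      using f g by (intro PiE_ext[OF f g]) auto
  qed
  moreover have "(\<lambda>f. lincomb f U) ` (U \<rightarrow>\<^sub>E UNIV) = span U"
  proof -
    \<comment> \<open>Values of \<open>f\<close> outside \<open>U\<close> do not affect the
      combination, so \<open>f\<close> may be cut down to an extensional function.\<close>
    have "lincomb f U \<in> (\<lambda>f. lincomb f U) ` (U \<rightarrow>\<^sub>E UNIV)" for f
      by (rule image_eqI[of _ _ "restrict f U"])
         (use U in \<open>auto intro!: lincomb_cong\<close>)
    then show ?thesis
      using U by (subst finite_span[OF fin]) auto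
  qed
  ultimately show ?thesis
    using card_image[of "\<lambda>f. lincomb f U" "U \<rightarrow>\<^sub>E UNIV"] fin by (simp add: card_PiE)
qed

text \<open>A maximal independent set of columns has \<open>rank A\<close> elements and spans all
  columns, so the count for independent sets applies to it.\<close>

lemma (in vec_space) card_col_space:
  assumes A: "A \<in> carrier_mat n nc"
  shows "card (col_space A) = card (UNIV :: 'a set) ^ rank A"
proof -
  let ?P = "\<lambda>T. T \<subseteq> set (cols A) \<and> lin_indpt T"
  have cols: "set (cols A) \<subseteq> carrier_vec n"
    using A cols_dim by blast
  have "?P {}"
    by (auto simp: lin_dep_def)
  then obtain U where fin: "finite U" and max: "maximal U ?P"
    using maximal_exists_superset[of "set (cols A)" ?P "{}"] by auto
  then have U: "U \<subseteq> set (cols A)" and indpt: "lin_indpt U"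
    by (auto simp: maximal_def)
  have Uc: "U \<subseteq> carrier_vec n"
    using U cols by blast
  have "set (cols A) \<subseteq> span U"
  proof
    fix s assume s: "s \<in> set (cols A)"
    \<comment> \<open>A column outside the span could be adjoined to \<open>U\<close> without losing
      independence, against maximality.\<close>
    show "s \<in> span U"
    proof (rule ccontr)
      assume "s \<notin> span U"
      moreover from this have "s \<notin> U"
        using span_mem[of U s] Uc by auto
      ultimately have "lin_indpt (U \<union> {s})"
        using lin_dep_iff_in_span[of U s] Uc indpt s cols by auto
      then show False
        using max s U \<open>s \<notin> U\<close> unfolding maximal_def by blast
    qed
  qed
  then have "span (set (cols A)) = span U"
    using U Uc by (metis span_is_monotone span_is_subset span_is_submodule subset_antisym)
  then show ?thesis
    using card_span_lin_indpt[OF fin Uc indpt] rank_card_indpt[OF A max]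
    by (simp add: col_space_def)
qed

section \<open>Fibres and kernels\<close>

text \<open>Every nonempty fibre of \<open>f\<close> is a translate of \<open>K\<close>. The
  codomain is left open so that the lemma covers both matrix maps, with vector values, and scalar
  products, with values in the field.\<close>

lemma card_carrier_vec_eq_image_times_kernel:
  fixes f :: "'a :: ab_group_add vec \<Rightarrow> 'b"
  assumes fin: "finite (UNIV :: 'a set)"
    and K: "K \<subseteq> carrier_vec n"
    and f: "\<And>x y. x \<in> carrier_vec n \<Longrightarrow> y \<in> carrier_vec n \<Longrightarrow> f x = f y \<longleftrightarrow> x - y \<in> K"
  shows "card (carrier_vec n :: 'a vec set) = card (f ` carrier_vec n) * card K"
proof -
  let ?C = "carrier_vec n :: 'a vec set"
  have finC: "finite ?C"
    using fin by (rule finite_carrier_vec)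
  have fibre: "card {x \<in> ?C. f x = y} = card K" if "y \<in> f ` ?C" for y
  proof -
    obtain x\<^sub>0 where x\<^sub>0: "x\<^sub>0 \<in> ?C" and y: "y = f x\<^sub>0"
      using \<open>y \<in> f ` ?C\<close> by blast
    have cancel: "v + x\<^sub>0 - x\<^sub>0 = v" "v - x\<^sub>0 + x\<^sub>0 = v" if "v \<in> ?C" for v
      using that x\<^sub>0 by (auto intro!: eq_vecI)
    \<comment> \<open>Translation by \<open>-x\<^sub>0\<close> carries the fibre through
      \<open>x\<^sub>0\<close> onto \<open>K\<close>.\<close>
    have "bij_betw (\<lambda>x. x - x\<^sub>0) {x \<in> ?C. f x = y} K"
    proof (rule bij_betwI[of _ _ _ "\<lambda>v. v + x\<^sub>0"])
      show "(\<lambda>v. v + x\<^sub>0) \<in> K \<rightarrow> {x \<in> ?C. f x = y}"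
      proof
        fix v assume v: "v \<in> K"
        then have "v \<in> ?C"
          using K by blast
        then show "v + x\<^sub>0 \<in> {x \<in> ?C. f x = y}"
          using f[of "v + x\<^sub>0" x\<^sub>0] x\<^sub>0 y v by (simp add: cancel)
      qed
    qed (use f x\<^sub>0 y K cancel in auto)
    then show ?thesis
      by (rule bij_betw_same_card)
  qed
  have "card ?C = card (\<Union>y\<in>f ` ?C. {x \<in> ?C. f x = y})"
    by (rule arg_cong[of _ _ card]) auto
  also have "\<dots> = (\<Sum>y\<in>f ` ?C. card {x \<in> ?C. f x = y})"
    using finC by (intro card_UN_disjoint) auto
  also have "\<dots> = card (f ` ?C) * card K"
    using fibre by simp
  finally show ?thesis .
qed

text \<open>Rank-nullity in its counting form; by linearity the fibres of the matrix map are the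
  cosets of its kernel.\<close>

lemma card_carrier_vec_eq_image_times_mat_kernel:
  fixes A :: "'a :: comm_ring_1 mat"
  assumes "finite (UNIV :: 'a set)" and A: "A \<in> carrier_mat nr nc"
  shows "card (UNIV :: 'a set) ^ nc =
           card ((\<lambda>x. A *\<^sub>v x) ` carrier_vec nc) * card (mat_kernel A)"
proof -
  have "A *\<^sub>v x = A *\<^sub>v y \<longleftrightarrow> x - y \<in> mat_kernel A"
    if x: "x \<in> carrier_vec nc" and y: "y \<in> carrier_vec nc" for x y
  proof -
    \<comment> \<open>Vectors of all lengths share one type, so this law is established for vectors
      of the common length \<open>nr\<close>.\<close>
    have "u = v \<longleftrightarrow> u - v = 0\<^sub>v nr" if "u \<in> carrier_vec nr" "v \<in> carrier_vec nr" for u v :: "'a vec"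
      using that by (auto simp: vec_eq_iff)
    then have "A *\<^sub>v x = A *\<^sub>v y \<longleftrightarrow> A *\<^sub>v x - A *\<^sub>v y = 0\<^sub>v nr"
      using A x y by (meson mult_mat_vec_carrier)
    then show ?thesis
      using x y A by (simp add: mat_kernel[OF A] mult_minus_distrib_mat_vec)
  qed
  from card_carrier_vec_eq_image_times_kernel[OF assms(1) mat_kernel_carrier[OF A] this]
  show ?thesis
    by (simp add: card_carrier_vec)
qed

section \<open>Double counting and the kernel of the transpose\<close>

text \<open>For nonzero \<open>w\<close> the functional \<open>y \<bullet> w\<close> maps onto the
  field, so its kernel is one q-th of the space, where q is the size of the field. The factor q on
  the left avoids a division and the exponent \<open>m - 1\<close>.\<close>

lemma card_orthogonal_vectors:
  fixes w :: "'a :: field vec"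
  assumes fin: "finite (UNIV :: 'a set)" and w: "w \<in> carrier_vec m"
  shows "card (UNIV :: 'a set) * card {y \<in> carrier_vec m. y \<bullet> w = 0} =
           card (UNIV :: 'a set) ^ m * (if w = 0\<^sub>v m then card (UNIV :: 'a set) else 1)"
proof (cases "w = 0\<^sub>v m")
  case True
  then have "{y \<in> carrier_vec m. y \<bullet> w = 0} = carrier_vec m"
    by auto
  then show ?thesis
    using True by (simp add: card_carrier_vec)
next
  case False
  then obtain i where i: "i < m" "w $ i \<noteq> 0"
    using w by (auto simp: vec_eq_iff)
  \<comment> \<open>A multiple of the unit vector at a nonzero coordinate of \<open>w\<close>,
    scaled to give the product \<open>c\<close>.\<close>
  have "c \<in> (\<lambda>y. y \<bullet> w) ` carrier_vec m" for c
    by (rule image_eqI[of _ _ "(c / w $ i) \<cdot>\<^sub>v unit_vec m i"]) (use i w in auto)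
  then have "(\<lambda>y. y \<bullet> w) ` carrier_vec m = UNIV"
    by blast
  moreover have "card (carrier_vec m :: 'a vec set) =
      card ((\<lambda>y. y \<bullet> w) ` carrier_vec m) * card {y \<in> carrier_vec m. y \<bullet> w = 0}"
    by (rule card_carrier_vec_eq_image_times_kernel[OF fin])
       (use w in \<open>auto simp: minus_scalar_prod_distrib\<close>)
  ultimately show ?thesis
    using False by (simp add: card_carrier_vec)
qed

text \<open>For fixed \<open>x\<close>, the admissible \<open>y\<close> are those orthogonal to
  \<open>A *\<^sub>v x\<close>: all of them if \<open>x\<close> is in the kernel, and one q-th of
  them otherwise.\<close>

lemma card_bilinear_zeros:
  fixes A :: "'a :: field mat"
  assumes fin: "finite (UNIV :: 'a set)" and A: "A \<in> carrier_mat nr nc"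
  defines "q \<equiv> card (UNIV :: 'a set)"
  shows "q * card {(x, y). x \<in> carrier_vec nc \<and> y \<in> carrier_vec nr \<and> y \<bullet> (A *\<^sub>v x) = 0} =
           q ^ nr * (q ^ nc + (q - 1) * card (mat_kernel A))"
proof -
  have q: "0 < q"
    using fin by (simp add: q_def card_gt_0_iff)
  note finC = finite_carrier_vec[OF fin]
  have "{(x, y). x \<in> carrier_vec nc \<and> y \<in> carrier_vec nr \<and> y \<bullet> (A *\<^sub>v x) = 0} =
      (SIGMA x : carrier_vec nc. {y \<in> carrier_vec nr. y \<bullet> (A *\<^sub>v x) = 0})"
    by auto
  then have "q * card {(x, y). x \<in> carrier_vec nc \<and> y \<in> carrier_vec nr \<and> y \<bullet> (A *\<^sub>v x) = 0} =
      (\<Sum>x\<in>carrier_vec nc. q * card {y \<in> carrier_vec nr. y \<bullet> (A *\<^sub>v x) = 0})"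
    by (simp add: finC sum_distrib_left)
  also have "\<dots> = (\<Sum>x\<in>carrier_vec nc. q ^ nr * (if A *\<^sub>v x = 0\<^sub>v nr then q else 1))"
    using card_orthogonal_vectors[OF fin, of _ nr] A
    by (intro sum.cong) (auto simp: q_def)
  \<comment> \<open>The weight is q on the kernel and 1 elsewhere, that is, 1 plus
    \<open>q - 1\<close> times the indicator of the kernel; since \<open>0 < q\<close>, the
    subtraction on naturals is exact.\<close>
  also have "\<dots> = q ^ nr * (\<Sum>x\<in>carrier_vec nc. 1 + (q - 1) * (if x \<in> mat_kernel A then 1 else 0))"
    unfolding sum_distrib_left using q
    by (intro sum.cong arg_cong2[of _ _ _ _ "(*)"]) (auto simp: mat_kernel[OF A])
  also have "(\<Sum>x\<in>carrier_vec nc. 1 + (q - 1) * (if x \<in> mat_kernel A then 1 else 0)) =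
      q ^ nc + (q - 1) * card (carrier_vec nc \<inter> mat_kernel A)"
    unfolding sum.distrib sum_distrib_left[symmetric]
    by (simp add: card_carrier_vec q_def sum.If_cases finC)
  also have "carrier_vec nc \<inter> mat_kernel A = mat_kernel A"
    using mat_kernel_carrier[OF A] by blast
  finally show ?thesis .
qed

text \<open>The counting form of equality of row rank and column rank. The zeros of the bilinear
  form of \<open>A\<close> are those of \<open>A\<^sup>T\<close> with the arguments swapped, and the
  previous count is applied to both.\<close>

lemma card_mat_kernel_transpose:
  fixes A :: "'a :: field mat"
  assumes fin: "finite (UNIV :: 'a set)" and A: "A \<in> carrier_mat nr nc"
  shows "card (UNIV :: 'a set) ^ nr * card (mat_kernel A) =
           card (UNIV :: 'a set) ^ nc * card (mat_kernel A\<^sup>T)"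
proof -
  define q where "q = card (UNIV :: 'a set)"
  \<comment> \<open>A field has at least the two elements 0 and 1, so the factor
    \<open>q - 1\<close> can be cancelled at the end.\<close>
  have "card {0 :: 'a, 1} \<le> q"
    unfolding q_def using fin by (intro card_mono) auto
  then have q: "q - 1 > 0"
    by simp
  have "bij_betw prod.swap
      {(x, y). x \<in> carrier_vec nc \<and> y \<in> carrier_vec nr \<and> y \<bullet> (A *\<^sub>v x) = 0}
      {(y, x). y \<in> carrier_vec nr \<and> x \<in> carrier_vec nc \<and> x \<bullet> (A\<^sup>T *\<^sub>v y) = 0}"
  proof (rule bij_betwI[of _ _ _ prod.swap])
    have "y \<bullet> (A *\<^sub>v x) = x \<bullet> (A\<^sup>T *\<^sub>v y)"
      if "x \<in> carrier_vec nc" "y \<in> carrier_vec nr" for x y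
      using transpose_vec_mult_scalar[OF A that] that A
      by (metis comm_scalar_prod mult_mat_vec_carrier transpose_carrier_mat)
    then show
      "prod.swap \<in> {(x, y). x \<in> carrier_vec nc \<and> y \<in> carrier_vec nr \<and> y \<bullet> (A *\<^sub>v x) = 0} \<rightarrow>
        {(y, x). y \<in> carrier_vec nr \<and> x \<in> carrier_vec nc \<and> x \<bullet> (A\<^sup>T *\<^sub>v y) = 0}"
      "prod.swap \<in> {(y, x). y \<in> carrier_vec nr \<and> x \<in> carrier_vec nc \<and> x \<bullet> (A\<^sup>T *\<^sub>v y) = 0} \<rightarrow>
        {(x, y). x \<in> carrier_vec nc \<and> y \<in> carrier_vec nr \<and> y \<bullet> (A *\<^sub>v x) = 0}"
      by auto
  qed auto
  then have "q ^ nr * (q ^ nc + (q - 1) * card (mat_kernel A)) =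
      q ^ nc * (q ^ nr + (q - 1) * card (mat_kernel A\<^sup>T))"
    using card_bilinear_zeros[OF fin A] card_bilinear_zeros[OF fin, of "A\<^sup>T" nc nr] A
    by (simp add: q_def bij_betw_same_card)
  \<comment> \<open>The kernel-free term \<open>q ^ nr * q ^ nc\<close> is the same on both sides
    and drops out.\<close>
  then have "(q - 1) * (q ^ nr * card (mat_kernel A)) = (q - 1) * (q ^ nc * card (mat_kernel A\<^sup>T))"
    by (simp add: algebra_simps)
  then show ?thesis
    using q by (simp add: q_def)
qed

lemma card_image_mat:
  fixes A :: "'a :: field mat"
  assumes A: "A \<in> carrier_mat nr nc"
  shows "card ((\<lambda>x. A *\<^sub>v x) ` carrier_vec nc) = card (UNIV :: 'a set) ^ vec_space.rank nr A"
proof -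
  interpret vec_space "TYPE('a)" nr .
  have "(\<lambda>x. A *\<^sub>v x) ` carrier_vec nc = col_space A"
    using A by (auto simp: col_space_eq[OF A])
  then show ?thesis
    by (simp add: card_col_space[OF A])
qed

text \<open>After multiplication by \<open>q ^ nc\<close>, the kernel of the transpose can be
  exchanged for that of \<open>A\<close>; rank-nullity then absorbs the latter.\<close>

lemma rank_times_left_kernel:
  fixes A :: "'a :: field mat"
  assumes fin: "finite (UNIV :: 'a set)" and A: "A \<in> carrier_mat nr nc"
  shows "card (UNIV :: 'a set) ^ vec_space.rank nr A * card (mat_kernel A\<^sup>T) =
           card (UNIV :: 'a set) ^ nr"
proof -
  define q where "q = card (UNIV :: 'a set)"
  have "0 < q"
    using fin by (simp add: q_def card_gt_0_iff)
  have "q ^ nc * (q ^ vec_space.rank nr A * card (mat_kernel A\<^sup>T)) =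
      q ^ vec_space.rank nr A * (q ^ nr * card (mat_kernel A))"
    using card_mat_kernel_transpose[OF fin A] by (simp add: q_def)
  also have "\<dots> = q ^ nc * q ^ nr"
    using card_carrier_vec_eq_image_times_mat_kernel[OF fin A]
    by (simp add: q_def card_image_mat[OF A])
  finally show ?thesis
    using \<open>0 < q\<close> by (simp add: q_def)
qed

section \<open>Formulas as linear systems over GF(2)\<close>

text \<open>The equations of the system \<open>A x = b\<close>: the support of row \<open>i\<close>
  is the variable set of clause \<open>i\<close>.\<close>

definition formula_of :: "nat \<Rightarrow> nat \<Rightarrow> bit mat \<times> bit vec \<Rightarrow> xor_clause list" where
  "formula_of L n = (\<lambda>(A, b). map (\<lambda>i. ({j. j < n \<and> A $$ (i, j) = 1}, b $ i)) [0..<L])"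

text \<open>A row over GF(2) is determined by its support. Hence a uniform formula amounts to a
  uniform matrix together with an independent uniform right-hand side.\<close>

lemma bij_betw_formula_of:
  "bij_betw (formula_of L n) (row_matrices L n k \<times> (carrier_vec L :: bit vec set)) (xor_formulas n L k)"
\<comment> \<open>The inverse takes the incidence matrix of the clauses and the vector of their
  right-hand sides.\<close>
proof (rule bij_betwI[of _ _ _
    "\<lambda>F. (mat L n (\<lambda>(i, j). of_bool (j \<in> fst (F ! i))), vec L (\<lambda>i. snd (F ! i)))"])
  show "formula_of L n \<in> row_matrices L n k \<times> carrier_vec L \<rightarrow> xor_formulas n L k"
    by (auto simp: formula_of_def row_matrices_def xor_formulas_def xor_clauses_def)
next
  have clause: "fst (F ! i) \<subseteq> {..<n}" "card (fst (F ! i)) = k"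
    if "F \<in> xor_formulas n L k" "i < L" for F i
  proof -
    have "F ! i \<in> xor_clauses n k"
      using that by (auto simp: xor_formulas_def)
    then show "fst (F ! i) \<subseteq> {..<n}" "card (fst (F ! i)) = k"
      by (auto simp: xor_clauses_def)
  qed
  have row: "{j. j < n \<and> mat L n (\<lambda>(i, j). of_bool (j \<in> fst (F ! i)) :: bit) $$ (i, j) = 1} =
      fst (F ! i)"
    if "F \<in> xor_formulas n L k" "i < L" for F i
    using clause[OF that] that by (auto simp: of_bool_def split: if_splits)
  show "(\<lambda>F. (mat L n (\<lambda>(i, j). of_bool (j \<in> fst (F ! i))), vec L (\<lambda>i. snd (F ! i))))
      \<in> xor_formulas n L k \<rightarrow> row_matrices L n k \<times> carrier_vec L"
    using row clause by (auto simp: row_matrices_def)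
  show "formula_of L n (mat L n (\<lambda>(i, j). of_bool (j \<in> fst (F ! i))), vec L (\<lambda>i. snd (F ! i))) = F"
    if "F \<in> xor_formulas n L k" for F
    using row[OF that] that
    by (intro nth_equalityI) (auto simp: formula_of_def xor_formulas_def)
next
  fix p :: "bit mat \<times> bit vec" assume p: "p \<in> row_matrices L n k \<times> carrier_vec L"
  have "(of_bool (x = 1) :: bit) = x" for x
    by (cases x) auto
  then show "(mat L n (\<lambda>(i, j). of_bool (j \<in> fst (formula_of L n p ! i))),
      vec L (\<lambda>i. snd (formula_of L n p ! i))) = p"
    using p by (cases p) (auto simp: formula_of_def row_matrices_def intro!: eq_matI eq_vecI)
qed

text \<open>Multiplying by a bit either selects or drops a summand, so an entry of the product is
  the left-hand side of a clause.\<close>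

lemma mult_mat_vec_bit_index:
  fixes A :: "bit mat"
  assumes A: "A \<in> carrier_mat L n" and v: "v \<in> carrier_vec n" and i: "i < L"
  shows "(A *\<^sub>v v) $ i = (\<Sum>j | j < n \<and> A $$ (i, j) = 1. v $ j)"
proof -
  have "x * y = (if x = 1 then y else 0)" for x y :: bit
    by (cases x) auto
  then have "(A *\<^sub>v v) $ i = (\<Sum>j\<in>{0..<n}. if A $$ (i, j) = 1 then v $ j else 0)"
    using assms by (auto simp: scalar_prod_def intro!: sum.cong)
  also have "\<dots> = (\<Sum>j | j < n \<and> A $$ (i, j) = 1. v $ j)"
    by (simp add: sum.inter_filter[symmetric])
  finally show ?thesis .
qed

lemma xor_satisfiable_formula_of:
  assumes A: "A \<in> carrier_mat L n" and b: "b \<in> carrier_vec L"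
  shows "xor_satisfiable n (formula_of L n (A, b)) \<longleftrightarrow> b \<in> (\<lambda>x. A *\<^sub>v x) ` carrier_vec n"
proof -
  have sat: "satisfies_formula I (formula_of L n (A, b)) \<longleftrightarrow> b = A *\<^sub>v vec n I" for I
  proof -
    have "(\<Sum>j | j < n \<and> A $$ (i, j) = 1. I j) = (A *\<^sub>v vec n I) $ i" if "i < L" for i
      using mult_mat_vec_bit_index[OF A _ that, of "vec n I"] by simp
    then show ?thesis
      using A b
      by (auto simp: satisfies_formula_def satisfies_clause_def formula_of_def vec_eq_iff
          simp del: index_mult_mat_vec)
  qed
  \<comment> \<open>Assignments yield every vector of length \<open>n\<close>, so satisfiability is
    exactly solvability of the system.\<close>
  have "vec n ` assignments n = carrier_vec n"
    unfolding assignments_def by (rule bij_betw_imp_surj_on[OF bij_betw_vec_carrier_vec])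
  then show ?thesis
    unfolding xor_satisfiable_def sat by (metis (no_types, lifting) image_iff)
qed

section \<open>Probabilities and ranks\<close>

text \<open>Satisfiable formulas correspond to pairs of a matrix and a vector in its image, so each
  \<open>A\<close> contributes \<open>2 ^ mat_rank A\<close> of its \<open>2 ^ L\<close> right-hand
  sides.\<close>

lemma prob_xor_sat_eq_sum:
  assumes "k \<le> n"
  shows "prob_xor_sat n L k =
    (\<Sum>A\<in>row_matrices L n k. 2 powi (int (mat_rank A) - int L)) / card (row_matrices L n k)"
proof -
  let ?M = "row_matrices L n k" and ?F = "xor_formulas n L k"
  let ?im = "\<lambda>A. (\<lambda>x. A *\<^sub>v x) ` (carrier_vec n :: bit vec set)"
  note bij = bij_betw_formula_of[of L n k]
  have carrier: "A \<in> carrier_mat L n" if "A \<in> ?M" for A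
    using that by (simp add: row_matrices_def)
  have cardF: "card ?F = card ?M * 2 ^ L"
    using bij_betw_same_card[OF bij]
    by (simp add: card_cartesian_product card_carrier_vec card_UNIV_bit)
  have im: "card (?im A) = 2 ^ mat_rank A" if "A \<in> ?M" for A
    using card_image_mat[OF carrier[OF that]] carrier[OF that]
    by (simp add: mat_rank_def card_UNIV_bit)
  have sub: "(SIGMA A : ?M. ?im A) \<subseteq> ?M \<times> carrier_vec L"
    using carrier by (auto intro: mult_mat_vec_carrier)
  have sat: "xor_satisfiable n (formula_of L n p) \<longleftrightarrow> p \<in> (SIGMA A : ?M. ?im A)"
    if "p \<in> ?M \<times> carrier_vec L" for p
    using that xor_satisfiable_formula_of[OF carrier] by (cases p) (simp only: mem_Sigma_iff simp_thms)
  have "?F \<inter> {F. xor_satisfiable n F} = formula_of L n ` (SIGMA A : ?M. ?im A)"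
    unfolding bij_betw_imp_surj_on[OF bij, symmetric]
  proof (intro equalityI subsetI)
    fix F assume "F \<in> formula_of L n ` (SIGMA A : ?M. ?im A)"
    then obtain p where p: "p \<in> (SIGMA A : ?M. ?im A)" and F: "F = formula_of L n p"
      by (rule imageE)
    have "p \<in> ?M \<times> carrier_vec L"
      using p sub by (rule rev_subsetD)
    then show "F \<in> formula_of L n ` (?M \<times> carrier_vec L) \<inter> {F. xor_satisfiable n F}"
      using sat[of p] p F by simp
  next
    fix F assume "F \<in> formula_of L n ` (?M \<times> carrier_vec L) \<inter> {F. xor_satisfiable n F}"
    then obtain p where "p \<in> ?M \<times> carrier_vec L" "F = formula_of L n p" "xor_satisfiable n F"
      by (elim IntE imageE CollectE)
    then show "F \<in> formula_of L n ` (SIGMA A : ?M. ?im A)"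
      using sat[of p] by (intro image_eqI[of _ _ p]) simp_all
  qed
  moreover have "inj_on (formula_of L n) (SIGMA A : ?M. ?im A)"
    by (rule inj_on_subset[OF bij_betw_imp_inj_on[OF bij] sub])
  ultimately have "card (?F \<inter> {F. xor_satisfiable n F}) = (\<Sum>A\<in>?M. card (?im A))"
    by (simp add: card_image finite_row_matrices finite_carrier_vec[OF finite_UNIV_bit])
  then have card_sat: "card (?F \<inter> {F. xor_satisfiable n F}) = (\<Sum>A\<in>?M. 2 ^ mat_rank A)"
    by (simp add: im)
  \<comment> \<open>The bound \<open>k \<le> n\<close> enters here: it makes the sample space
    nonempty, so that probabilities under \<open>pmf_of_set\<close> are ratios of
    cardinalities.\<close>
  have "card ?M > 0"
    using row_matrices_nonempty[OF assms] by (simp add: card_gt_0_iff finite_row_matrices)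
  then have "?F \<noteq> {}"
    using cardF by auto
  then have "prob_xor_sat n L k = (\<Sum>A\<in>?M. 2 ^ mat_rank A) / (card ?M * 2 ^ L)"
    by (simp add: prob_xor_sat_def random_xor_formula_def measure_pmf_of_set finite_xor_formulas
        card_sat cardF)
  then show ?thesis
    by (simp add: power_int_diff sum_divide_distrib mult.commute)
qed

lemma mat_rank_num_left_kernel:
  assumes "A \<in> row_matrices L n k"
  shows "mat_rank A \<le> L" and "1 / real (num_left_kernel A) = 2 powi (int (mat_rank A) - int L)"
proof -
  have "A \<in> carrier_mat L n"
    using assms by (simp add: row_matrices_def)
  then have eq: "2 ^ mat_rank A * num_left_kernel A = 2 ^ L"
    using rank_times_left_kernel[OF finite_UNIV_bit]
    by (auto simp: mat_rank_def num_left_kernel_def card_UNIV_bit)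
  \<comment> \<open>The bound on the rank is read off from divisibility of powers of 2.\<close>
  then have "2 ^ mat_rank A dvd (2 :: nat) ^ L"
    by (metis dvd_triv_left)
  then show "mat_rank A \<le> L"
    by (simp add: power_dvd_imp_le)
  have "2 ^ mat_rank A * real (num_left_kernel A) = 2 ^ L"
    using arg_cong[OF eq, of real] by simp
  \<comment> \<open>A zero count, for which the quotient would default to 0, would contradict the
    equation, whose right-hand side is nonzero.\<close>
  then show "1 / real (num_left_kernel A) = 2 powi (int (mat_rank A) - int L)"
    by (cases "num_left_kernel A = 0") (auto simp: power_int_diff field_simps)
qed

theorem theorem2:
  fixes k n L :: nat
  assumes "3 \<le> k" and "k \<le> n"
  shows "prob_xor_sat n L k = (\<Sum>r=0..L. 2 powi (int r - int L) * prob_rank L n k r) \<and>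
         (\<Sum>r=0..L. 2 powi (int r - int L) * prob_rank L n k r) =
           measure_pmf.expectation (random_matrix L n k) (\<lambda>A. 1 / real (num_left_kernel A))"
proof -
  let ?M = "row_matrices L n k" and ?w = "\<lambda>r. 2 powi (int r - int L) :: real"
  note M = row_matrices_nonempty[OF assms(2), of L] finite_row_matrices[of L n k]
  \<comment> \<open>Each rank probability is a share of matrices, and on the matrices of rank
    \<open>r\<close> the weight may be written with \<open>mat_rank A\<close> in place of
    \<open>r\<close>.\<close>
  have "(\<Sum>r=0..L. ?w r * prob_rank L n k r) =
      (\<Sum>r=0..L. \<Sum>A | A \<in> ?M \<and> mat_rank A = r. ?w (mat_rank A)) / card ?M"
    using M
    by (simp add: prob_rank_def random_matrix_def measure_pmf_of_set sum_divide_distrib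
        Int_def mult.commute)
  \<comment> \<open>Grouping by rank loses no matrix, because every rank is at most
    \<open>L\<close>.\<close>
  also have "(\<Sum>r=0..L. \<Sum>A | A \<in> ?M \<and> mat_rank A = r. ?w (mat_rank A)) =
      (\<Sum>A\<in>?M. ?w (mat_rank A))"
    using M mat_rank_num_left_kernel(1) by (intro sum.group) auto
  finally have ranks: "(\<Sum>r=0..L. ?w r * prob_rank L n k r) =
      (\<Sum>A\<in>?M. ?w (mat_rank A)) / card ?M" .
  have "measure_pmf.expectation (random_matrix L n k) (\<lambda>A. 1 / real (num_left_kernel A)) =
      (\<Sum>A\<in>?M. 1 / real (num_left_kernel A)) / card ?M"
    using M by (simp add: random_matrix_def integral_pmf_of_set)
  \<comment> \<open>The two averages agree matrix by matrix, not only in total.\<close>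
  also have "(\<Sum>A\<in>?M. 1 / real (num_left_kernel A)) = (\<Sum>A\<in>?M. ?w (mat_rank A))"
    by (intro sum.cong refl mat_rank_num_left_kernel(2))
  finally show ?thesis
    using prob_xor_sat_eq_sum[OF assms(2), of L] ranks by simp
qed

end
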